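(* Let $H$ be a separable (infinite-dimensional, complex) Hilbert space and let $\{e_n\}_{n=1}^{\infty}$ be a Riesz basis of $H$. Let $\lambda_n=i\ln n$, $n\in\mathbb{N}$, and define the operator $A: H_1(\{e_n\})\supset D(A)\to H_1(\{e_n\})$ by $$A\,(\mathfrak{f})\sum_{n=1}^{\infty}c_ne_n=(\mathfrak{f})\sum_{n=1}^{\infty}\lambda_n c_ne_n,$$ $$D(A)=\Bigl\{x=(\mathfrak{f})\sum_{n=1}^{\infty}c_ne_n\in H_1(\{e_n\}):\ \{\lambda_nc_n\}_{n=1}^{\infty}\in\ell_2(\Delta)\Bigr\}.$$ Then $A$ is the generator of a $C_0$-group $\{e^{At}\}_{t\in\mathbb{R}}$ on $H_1(\{e_n\})$, which acts for every $t\in\mathbb{R}$ by the formula $$e^{At}\,(\mathfrak{f})\sum_{n=1}^{\infty}c_ne_n=(\mathfrak{f})\sum_{n=1}^{\infty}e^{it\ln n}c_ne_n .$$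
   Context: $(\mathfrak{f})\sum_{n=1}^\infty c_ne_n$ denotes a formal series, i.e. it is identified with its coefficient sequence $\{c_n\}_{n=1}^\infty$ of complex numbers (no convergence is required). With the convention $c_0=0$, $\ell_2(\Delta)$ is the set of complex sequences $\{c_n\}_{n=1}^\infty$ with $\{c_n-c_{n-1}\}_{n=1}^\infty\in\ell_2$. For a Riesz basis $\{e_n\}$ of $H$ (the image of an orthonormal basis under a bounded, boundedly invertible operator), $H_1(\{e_n\})$ is the space of formal series $x=(\mathfrak{f})\sum_{n=1}^\infty c_ne_n$ with $\{c_n\}\in\ell_2(\Delta)$, with coefficientwise linear operations and norm $\|x\|_1=\bigl\|\sum_{n=1}^\infty(c_n-c_{n-1})e_n\bigr\|$, where $\|\cdot\|$ is the norm of $H$. It is a Hilbert space; equivalently, it is the completion of $H$ in the norm $\|(I-T)x\|$, where $T\in B(H)$ is the right shift $Te_n=e_{n+1}$. *)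

theory Defs
  imports "HOL-Analysis.Analysis" "HOL-Library.Function_Algebras"
begin

text \<open>
  Completeness and the topology come from \<^class>\<open>banach\<close>, whose real scalar multiplication is
  required to be the restriction of the complex one and whose norm is the one induced by the
  inner product.
\<close>

class complex_hilbert = banach +
  fixes scaleC :: "complex \<Rightarrow> 'a \<Rightarrow> 'a"  (infixr "*\<^sub>C" 75)
    and cinner :: "'a \<Rightarrow> 'a \<Rightarrow> complex"
  assumes scaleC_of_real: "complex_of_real r *\<^sub>C x = r *\<^sub>R x"
    and scaleC_scaleC: "a *\<^sub>C (b *\<^sub>C x) = (a * b) *\<^sub>C x"
    and scaleC_add_right: "a *\<^sub>C (x + y) = a *\<^sub>C x + a *\<^sub>C y"
    and scaleC_add_left: "(a + b) *\<^sub>C x = a *\<^sub>C x + b *\<^sub>C x"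
    and cinner_commute: "cinner x y = cnj (cinner y x)"
    and cinner_add_left: "cinner (x + y) z = cinner x z + cinner y z"
    and cinner_scaleC_left: "cinner (a *\<^sub>C x) y = a * cinner x y"
    and cinner_self: "cinner x x = complex_of_real ((norm x)\<^sup>2)"

global_interpretation complex_vector:
  vector_space "scaleC :: complex \<Rightarrow> 'a \<Rightarrow> 'a::complex_hilbert"
proof unfold_locales
  show "1 *\<^sub>C x = x" for x :: 'a
    using scaleC_of_real [of 1 x] by simp
qed (rule scaleC_add_right scaleC_add_left scaleC_scaleC)+

definition infinite_dimensional :: "'a::complex_hilbert itself \<Rightarrow> bool" where
  "infinite_dimensional _ \<longleftrightarrow> (\<nexists>B::'a set. finite B \<and> complex_vector.span B = UNIV)"

definition bounded_clinear :: "('a::complex_hilbert \<Rightarrow> 'a) \<Rightarrow> bool" where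
  "bounded_clinear S \<longleftrightarrow>
     Vector_Spaces.linear scaleC scaleC S \<and> (\<exists>K. \<forall>x. norm (S x) \<le> K * norm x)"

definition orthonormal_basis :: "'i set \<Rightarrow> ('i \<Rightarrow> 'a::complex_hilbert) \<Rightarrow> bool" where
  "orthonormal_basis I f \<longleftrightarrow>
     (\<forall>m\<in>I. \<forall>n\<in>I. cinner (f m) (f n) = (if m = n then 1 else 0)) \<and>
     closure (complex_vector.span (f ` I)) = UNIV"

definition riesz_basis :: "'i set \<Rightarrow> ('i \<Rightarrow> 'a::complex_hilbert) \<Rightarrow> bool" where
  "riesz_basis I e \<longleftrightarrow>
     (\<exists>f S R. orthonormal_basis I f \<and> bounded_clinear S \<and> bounded_clinear R \<and>
        S \<circ> R = id \<and> R \<circ> S = id \<and> (\<forall>n\<in>I. e n = S (f n)))"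

locale complex_banach_on =
  vector_space smul for smul :: "complex \<Rightarrow> 'v::ab_group_add \<Rightarrow> 'v" +
  fixes X :: "'v set" and N :: "'v \<Rightarrow> real"
  assumes subspace_carrier: "subspace X"
    and norm_ge_zero: "x \<in> X \<Longrightarrow> 0 \<le> N x"
    and norm_eq_zero: "x \<in> X \<Longrightarrow> N x = 0 \<longleftrightarrow> x = 0"
    and norm_triangle: "x \<in> X \<Longrightarrow> y \<in> X \<Longrightarrow> N (x + y) \<le> N x + N y"
    and norm_scale: "x \<in> X \<Longrightarrow> N (smul a x) = cmod a * N x"
    and complete: "(\<And>n. s n \<in> X) \<Longrightarrow>
      (\<And>\<epsilon>. 0 < \<epsilon> \<Longrightarrow> \<exists>M. \<forall>m\<ge>M. \<forall>n\<ge>M. N (s m - s n) < \<epsilon>) \<Longrightarrow>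
      \<exists>x\<in>X. (\<lambda>n::nat. N (s n - x)) \<longlonglongrightarrow> 0"

text \<open>
  Operators on the carrier \<open>X\<close> are represented by functions on the ambient type, whose values
  outside of \<open>X\<close> are irrelevant.
\<close>

locale C0_group = complex_banach_on smul X N
  for smul :: "complex \<Rightarrow> 'v::ab_group_add \<Rightarrow> 'v" and X :: "'v set" and N :: "'v \<Rightarrow> real" +
  fixes T :: "real \<Rightarrow> 'v \<Rightarrow> 'v"
  assumes maps_to: "x \<in> X \<Longrightarrow> T t x \<in> X"
    and add: "x \<in> X \<Longrightarrow> y \<in> X \<Longrightarrow> T t (x + y) = T t x + T t y"
    and scale: "x \<in> X \<Longrightarrow> T t (smul a x) = smul a (T t x)"
    and bounded: "\<exists>K. \<forall>x\<in>X. N (T t x) \<le> K * N x"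
    and group_zero: "x \<in> X \<Longrightarrow> T 0 x = x"
    and group_add: "x \<in> X \<Longrightarrow> T (s + t) x = T s (T t x)"
    and strongly_continuous: "x \<in> X \<Longrightarrow> ((\<lambda>s. N (T s x - T t x)) \<longlongrightarrow> 0) (at t)"

definition has_generator_value ::
    "(complex \<Rightarrow> 'v::ab_group_add \<Rightarrow> 'v) \<Rightarrow> ('v \<Rightarrow> real) \<Rightarrow> (real \<Rightarrow> 'v \<Rightarrow> 'v) \<Rightarrow> 'v \<Rightarrow> 'v \<Rightarrow> bool" where
  "has_generator_value smul N T x y \<longleftrightarrow>
     ((\<lambda>h. N (smul (complex_of_real (1 / h)) (T h x - x) - y)) \<longlongrightarrow> 0) (at 0)"

definition is_generator ::
    "(complex \<Rightarrow> 'v::ab_group_add \<Rightarrow> 'v) \<Rightarrow> 'v set \<Rightarrow> ('v \<Rightarrow> real) \<Rightarrow> (real \<Rightarrow> 'v \<Rightarrow> 'v)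
      \<Rightarrow> 'v set \<Rightarrow> ('v \<Rightarrow> 'v) \<Rightarrow> bool" where
  "is_generator smul X N T D A \<longleftrightarrow>
     D = {x \<in> X. \<exists>y\<in>X. has_generator_value smul N T x y} \<and>
     (\<forall>x\<in>D. A x \<in> X \<and> has_generator_value smul N T x (A x))"

text \<open>
  A formal series \<open>\<Sum>n\<ge>1. c n e\<^sub>n\<close> is identified with its coefficient sequence, extended by
  \<open>c 0 = 0\<close>. Members of \<open>ell2_Delta\<close> satisfy this convention, so that they correspond exactly to
  sequences indexed by \<open>n \<ge> 1\<close>.
\<close>

definition ell2_Delta :: "(nat \<Rightarrow> complex) set" where
  "ell2_Delta = {c. c 0 = 0 \<and> summable (\<lambda>n. (cmod (c (Suc n) - c n))\<^sup>2)}"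

definition seq_scale :: "complex \<Rightarrow> (nat \<Rightarrow> complex) \<Rightarrow> nat \<Rightarrow> complex" where
  "seq_scale a c = (\<lambda>n. a * c n)"

text \<open>
  The carrier of \<open>H\<^sub>1({e\<^sub>n})\<close> is \<open>ell2_Delta\<close> for every \<open>e\<close>; only its norm depends on \<open>e\<close>.
  The value \<open>e 0\<close> is not used.
\<close>

definition H1_norm :: "(nat \<Rightarrow> 'a::complex_hilbert) \<Rightarrow> (nat \<Rightarrow> complex) \<Rightarrow> real" where
  "H1_norm e c = norm (\<Sum>n. (c (Suc n) - c n) *\<^sub>C e (Suc n))"

definition diag_op :: "(nat \<Rightarrow> complex) \<Rightarrow> (nat \<Rightarrow> complex) \<Rightarrow> nat \<Rightarrow> complex" where
  "diag_op \<mu> c = (\<lambda>n. \<mu> n * c n)"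

definition diag_domain :: "(nat \<Rightarrow> complex) \<Rightarrow> (nat \<Rightarrow> complex) set" where
  "diag_domain \<mu> = {c \<in> ell2_Delta. diag_op \<mu> c \<in> ell2_Delta}"

end

theory Submission
  imports Defs
begin

text \<open>
  Since \<open>{e\<^sub>n}\<close> is a Riesz basis, the norm of \<open>H\<^sub>1\<close> is equivalent to the \<open>\<ell>\<^sub>2\<close> norm of the increments
  \<open>c\<^sub>n - c\<^sub>n\<^sub>-\<^sub>1\<close>. Summation by parts turns the increments of \<open>(m\<^sub>n c\<^sub>n)\<close> into
  \<open>m\<^sub>n\<^sub>+\<^sub>1 (c\<^sub>n\<^sub>+\<^sub>1 - c\<^sub>n) + (m\<^sub>n\<^sub>+\<^sub>1 - m\<^sub>n) c\<^sub>n\<close>. By Hardy's inequality \<open>(c\<^sub>n / n)\<close> is square summable, so a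
  bounded sequence \<open>m\<close> with \<open>\<bar>m\<^sub>n\<^sub>+\<^sub>1 - m\<^sub>n\<bar> \<le> K / n\<close> is a bounded multiplier. Both \<open>n\<^sup>i\<^sup>t\<close> and
  \<open>\<psi> (h ln n)\<close>, where \<open>\<psi> x = (e\<^sup>i\<^sup>x - 1) / (i x)\<close>, are of this kind, because
  \<open>ln (n + 1) - ln n \<le> 1 / n\<close>. For multipliers that tend to zero pointwise with uniform
  constants, dominated convergence yields strong convergence to zero: this gives strong continuity
  at once, and also the generator, since the difference quotient of the group at \<open>c\<close> is the
  multiplier \<open>\<psi> (h ln n)\<close> applied to \<open>A c\<close>. Continuity of the coordinates shows that the
  domain of the generator is not larger.
\<close>

subsection \<open>Elementary estimates\<close>

lemma norm_add_squared_le: "(norm (x + y))\<^sup>2 \<le> 2 * (norm x)\<^sup>2 + 2 * (norm (y :: 'a::real_normed_vector))\<^sup>2"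
proof -
  have "(norm (x + y))\<^sup>2 \<le> (norm x + norm y)\<^sup>2"
    by (intro power_mono norm_triangle_ineq) simp
  also have "\<dots> \<le> 2 * (norm x)\<^sup>2 + 2 * (norm y)\<^sup>2"
    using sum_squares_bound [of "norm x" "norm y"] by (simp add: power2_sum)
  finally show ?thesis .
qed

text \<open>The mean value inequality is applied on the imaginary axis, a convex set on which the
  derivative of \<open>exp\<close> has modulus \<open>1\<close>.\<close>

lemma cmod_exp_imaginary_diff_le:
  "cmod (exp (\<i> * complex_of_real x) - exp (\<i> * complex_of_real y)) \<le> \<bar>x - y\<bar>"
proof -
  have "cmod (exp (\<i> * complex_of_real x) - exp (\<i> * complex_of_real y)) \<le>
      1 * cmod (\<i> * complex_of_real x - \<i> * complex_of_real y)"
  proof (rule field_differentiable_bound)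
    show "convex {z. Re z = 0}"
      by (auto simp: convex_def)
    show "(exp has_field_derivative exp z) (at z within {z. Re z = 0})" for z :: complex
      by (intro DERIV_subset [OF DERIV_exp]) auto
  qed auto
  also have "\<dots> = cmod (\<i> * complex_of_real (x - y))"
    by (simp add: algebra_simps)
  also have "\<dots> = \<bar>x - y\<bar>"
    unfolding norm_mult norm_of_real by simp
  finally show ?thesis .
qed

text \<open>This is \<open>ln (1 + x) \<le> x\<close> at \<open>x = 1 / n\<close>. The decay
  \<open>1 / n\<close> is the weight in Hardy's inequality, which is why logarithmic frequencies are
  admissible.\<close>

lemma ln_Suc_diff_le:
  assumes "1 \<le> n"
  shows "\<bar>ln (real (Suc n)) - ln (real n)\<bar> \<le> 1 / real n"
proof -
  have "ln (real (Suc n)) - ln (real n) = ln (real (Suc n) / real n)"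
    using assms by (subst ln_div) auto
  also have "\<dots> = ln (1 + 1 / real n)"
    using assms by (simp add: field_simps)
  also have "\<dots> \<le> 1 / real n"
    by (rule ln_add_one_self_le_self) simp
  finally show ?thesis
    using assms by (simp add: ln_le_cancel_iff)
qed

text \<open>Equals \<open>(e\<^sup>i\<^sup>x - 1) / (i x)\<close>; the integral form has no singularity at \<open>x = 0\<close> and makes the
  Lipschitz bound immediate.\<close>

definition exp_quotient :: "real \<Rightarrow> complex" where
  "exp_quotient x = integral {0..1} (\<lambda>s. exp (\<i> * complex_of_real (s * x)))"

lemma exp_quotient_integrable:
  "(\<lambda>s. exp (\<i> * complex_of_real (s * x))) integrable_on {0..1}"
  by (intro integrable_continuous_interval continuous_intros)

text \<open>The fundamental theorem of calculus for \<open>exp (i s x)\<close> as a function of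
  \<open>s\<close> on the unit interval. In product form, \<open>x = 0\<close> is no
  exception.\<close>

lemma exp_quotient_mult: "\<i> * complex_of_real x * exp_quotient x = exp (\<i> * complex_of_real x) - 1"
proof -
  have "((\<lambda>s. \<i> * complex_of_real x * exp (\<i> * complex_of_real (s * x))) has_integral
      exp (\<i> * complex_of_real (1 * x)) - exp (\<i> * complex_of_real (0 * x))) {0..1}"
  proof (rule fundamental_theorem_of_calculus)
    fix s :: real
    \<comment> \<open>The derivative is taken in a complex variable and then restricted to the real
      line.\<close>
    have "((\<lambda>z. exp (\<i> * (z * complex_of_real x))) has_field_derivative
        \<i> * complex_of_real x * exp (\<i> * (complex_of_real s * complex_of_real x))) (at (complex_of_real s))"
      by (auto intro!: derivative_eq_intros)
    from has_vector_derivative_real_field [OF this]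
    show "((\<lambda>s. exp (\<i> * complex_of_real (s * x))) has_vector_derivative
        \<i> * complex_of_real x * exp (\<i> * complex_of_real (s * x))) (at s within {0..1})"
      by (simp add: has_vector_derivative_at_within)
  qed simp
  moreover have "((\<lambda>s. \<i> * complex_of_real x * exp (\<i> * complex_of_real (s * x))) has_integral
      \<i> * complex_of_real x * exp_quotient x) {0..1}"
    unfolding exp_quotient_def
    by (intro has_integral_mult_right integrable_integral exp_quotient_integrable)
  ultimately have "\<i> * complex_of_real x * exp_quotient x
      = exp (\<i> * complex_of_real (1 * x)) - exp (\<i> * complex_of_real (0 * x))"
    by (rule has_integral_unique [rotated])
  then show ?thesis
    by simp
qed

lemma exp_quotient_diff_le: "cmod (exp_quotient x - exp_quotient y) \<le> \<bar>x - y\<bar>"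
proof -
  have "exp_quotient x - exp_quotient y =
      integral {0..1} (\<lambda>s. exp (\<i> * complex_of_real (s * x)) - exp (\<i> * complex_of_real (s * y)))"
    unfolding exp_quotient_def
    by (intro Henstock_Kurzweil_Integration.integral_diff [symmetric] exp_quotient_integrable)
  also have "cmod \<dots> \<le> \<bar>x - y\<bar> * (1 - 0)"
  proof (rule integral_bound)
    show "cmod (exp (\<i> * complex_of_real (s * x)) - exp (\<i> * complex_of_real (s * y))) \<le> \<bar>x - y\<bar>"
      if "s \<in> {0..1}" for s
    proof -
      have "\<bar>s * x - s * y\<bar> = s * \<bar>x - y\<bar>"
        using that by (simp add: abs_mult flip: right_diff_distrib)
      also have "\<dots> \<le> \<bar>x - y\<bar>"
        using that by (simp add: mult_left_le_one_le)
      finally show ?thesis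
        using cmod_exp_imaginary_diff_le order_trans by blast
    qed
  qed (auto intro!: continuous_intros)
  finally show ?thesis by simp
qed

lemma exp_quotient_0: "exp_quotient 0 = 1"
  by (simp add: exp_quotient_def)

lemma cmod_exp_quotient_le: "cmod (exp_quotient x) \<le> 1"
proof -
  have "cmod (exp_quotient x) \<le> 1 * (1 - 0)"
    unfolding exp_quotient_def
    by (rule integral_bound) (auto intro!: continuous_intros)
  then show ?thesis by simp
qed

text \<open>The boundary term \<open>2 N (a N / N)\<^sup>2\<close> makes the induction go through. At \<open>N = 0\<close> the
  division by zero yields \<open>0\<close>.\<close>

lemma hardy_partial:
  fixes a :: "nat \<Rightarrow> 'a::real_normed_vector"
  assumes "a 0 = 0"
  shows "(\<Sum>n<N. (norm (a (Suc n)) / real (Suc n))\<^sup>2) + 2 * real N * (norm (a N) / real N)\<^sup>2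
    \<le> 4 * (\<Sum>n<N. (norm (a (Suc n) - a n))\<^sup>2)"
proof (induction N)
  case (Suc N)
  define p q \<delta> where "p = norm (a N) / real N" and "q = norm (a (Suc N)) / real (Suc N)"
    and "\<delta> = norm (a (Suc N) - a N)"
  \<comment> \<open>For \<open>N = 0\<close> the quotient \<open>p\<close> is \<open>0\<close> by
    division by zero, and the equation holds because \<open>a 0 = 0\<close>.\<close>
  have N: "real N * p = norm (a N)"
    using assms by (cases "N = 0") (simp_all add: p_def)
  have S: "(real N + 1) * q = norm (a (Suc N))"
    by (simp add: q_def field_simps)
  have "(real N + 1) * q \<le> real N * p + \<delta>"
    unfolding N S \<delta>_def using norm_triangle_sub [of "a (Suc N)" "a N"] by simp
  moreover have "0 \<le> q"
    by (simp add: q_def)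
  ultimately have "q * ((real N + 1) * q) \<le> q * (real N * p + \<delta>)"
    by (rule mult_left_mono)
  \<comment> \<open>Adding four times the previous inequality, twice the first of these and once the
    second cancels the products \<open>p * q\<close> and \<open>q * \<delta>\<close>; the factor
    \<open>2 * N + 3\<close> of \<open>q\<^sup>2\<close> remains.\<close>
  moreover have "0 \<le> real N * (p - q)\<^sup>2" "0 \<le> (q - 2 * \<delta>)\<^sup>2"
    by simp_all
  ultimately have "q\<^sup>2 + 2 * (real N + 1) * q\<^sup>2 \<le> 2 * real N * p\<^sup>2 + 4 * \<delta>\<^sup>2"
    by (simp add: power2_eq_square algebra_simps)
  then have "q\<^sup>2 + 2 * real (Suc N) * q\<^sup>2 \<le> 2 * real N * p\<^sup>2 + 4 * \<delta>\<^sup>2"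
    by (simp only: of_nat_Suc add.commute)
  then have "(\<Sum>n<N. (norm (a (Suc n)) / real (Suc n))\<^sup>2) + (q\<^sup>2 + 2 * real (Suc N) * q\<^sup>2)
      \<le> (\<Sum>n<N. (norm (a (Suc n)) / real (Suc n))\<^sup>2) + (2 * real N * p\<^sup>2 + 4 * \<delta>\<^sup>2)"
    by (rule add_left_mono)
  also have "\<dots> \<le> 4 * (\<Sum>n<N. (norm (a (Suc n) - a n))\<^sup>2) + 4 * \<delta>\<^sup>2"
    using Suc.IH unfolding p_def [symmetric] by simp
  finally show ?case
    by (simp only: sum.lessThan_Suc q_def \<delta>_def distrib_left add.assoc)
qed simp

subsection \<open>Multipliers with slowly varying symbol\<close>

text \<open>The squared norm of H_1 for an orthonormal basis. As it does not depend on
  \<open>e\<close>, multipliers can be estimated here first and the result transferred to any Riesz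
  basis.\<close>

definition increment_energy :: "(nat \<Rightarrow> complex) \<Rightarrow> real" where
  "increment_energy c = (\<Sum>n. (cmod (c (Suc n) - c n))\<^sup>2)"

lemma ell2_Delta_zeroD: "c \<in> ell2_Delta \<Longrightarrow> c 0 = 0"
  and ell2_Delta_summableD: "c \<in> ell2_Delta \<Longrightarrow> summable (\<lambda>n. (cmod (c (Suc n) - c n))\<^sup>2)"
  by (auto simp: ell2_Delta_def)

lemma sum_increments_le_energy:
  "c \<in> ell2_Delta \<Longrightarrow> (\<Sum>n<N. (cmod (c (Suc n) - c n))\<^sup>2) \<le> increment_energy c"
  unfolding increment_energy_def by (intro sum_le_suminf ell2_Delta_summableD) auto

lemma increment_energy_nonneg: "c \<in> ell2_Delta \<Longrightarrow> 0 \<le> increment_energy c"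
  unfolding increment_energy_def by (intro suminf_nonneg ell2_Delta_summableD) auto

lemma increment_le_energy:
  assumes "c \<in> ell2_Delta"
  shows "cmod (c (Suc n) - c n) \<le> sqrt (increment_energy c)"
proof -
  have "(cmod (c (Suc n) - c n))\<^sup>2 \<le> (\<Sum>k<Suc n. (cmod (c (Suc k) - c k))\<^sup>2)"
    by (simp add: sum_nonneg)
  also have "\<dots> \<le> increment_energy c"
    using assms by (rule sum_increments_le_energy)
  finally show ?thesis
    by (rule real_le_rsqrt)
qed

text \<open>Telescoping from \<open>c 0 = 0\<close>, with each increment at most the square root of
  the energy. The growth in \<open>n\<close> is not optimal, but it makes every coordinate
  continuous.\<close>

lemma coordinate_le_energy:
  assumes "c \<in> ell2_Delta"
  shows "cmod (c n) \<le> real n * sqrt (increment_energy c)"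
proof (induction n)
  case 0
  then show ?case
    using ell2_Delta_zeroD [OF assms] by simp
next
  case (Suc n)
  have "cmod (c (Suc n)) \<le> cmod (c n) + cmod (c (Suc n) - c n)"
    by (rule norm_triangle_sub)
  also have "\<dots> \<le> real (Suc n) * sqrt (increment_energy c)"
    using Suc.IH increment_le_energy [OF assms, of n] by (simp add: algebra_simps)
  finally show ?case .
qed

lemma hardy:
  assumes "c \<in> ell2_Delta"
  shows "summable (\<lambda>n. (cmod (c n) / real n)\<^sup>2)"
    and "(\<Sum>n. (cmod (c n) / real n)\<^sup>2) \<le> 4 * increment_energy c"
proof -
  have *: "(\<Sum>n<N. (cmod (c n) / real n)\<^sup>2) \<le> 4 * increment_energy c" for N
  proof -
    \<comment> \<open>The sum gets one more term so that, once its vanishing term at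
      \<open>0\<close> is split off, it has the shifted form of
      \<open>hardy_partial\<close>.\<close>
    have "(\<Sum>n<N. (cmod (c n) / real n)\<^sup>2) \<le> (\<Sum>n<Suc N. (cmod (c n) / real n)\<^sup>2)"
      by simp
    also have "\<dots> = (\<Sum>n<N. (cmod (c (Suc n)) / real (Suc n))\<^sup>2)"
      by (subst sum.lessThan_Suc_shift) simp
    also have "\<dots> \<le> \<dots> + 2 * real N * (cmod (c N) / real N)\<^sup>2"
      by simp
    also have "\<dots> \<le> 4 * (\<Sum>n<N. (cmod (c (Suc n) - c n))\<^sup>2)"
      using hardy_partial ell2_Delta_zeroD [OF assms] by blast
    also have "\<dots> \<le> 4 * increment_energy c"
      using sum_increments_le_energy [OF assms] by simp
    finally show ?thesis .
  qed
  show "summable (\<lambda>n. (cmod (c n) / real n)\<^sup>2)"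
    by (rule summableI_nonneg_bounded [OF _ *]) simp
  then show "(\<Sum>n. (cmod (c n) / real n)\<^sup>2) \<le> 4 * increment_energy c"
    using * by (rule suminf_le_const)
qed

section \<open>Bounds and convergence for diagonal multipliers\<close>

lemma diag_op_increment:
  "diag_op m c (Suc n) - diag_op m c n = m (Suc n) * (c (Suc n) - c n) + (m (Suc n) - m n) * c n"
  by (simp add: diag_op_def algebra_simps)

text \<open>In the product rule for increments, \<open>m 0\<close> occurs only in a product with
  \<open>c 0 = 0\<close>, so bounds for \<open>n \<ge> 1\<close> suffice. The estimate sees
  \<open>m\<close> only through \<open>B\<close> and \<open>K\<close>, which makes it a majorant for
  whole families of multipliers.\<close>

lemma diag_op_increment_le:
  assumes "c 0 = 0" "\<And>n. 1 \<le> n \<Longrightarrow> cmod (m n) \<le> B"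
    and "\<And>n. 1 \<le> n \<Longrightarrow> cmod (m (Suc n) - m n) \<le> K / real n"
  shows "(cmod (diag_op m c (Suc n) - diag_op m c n))\<^sup>2
    \<le> 2 * B\<^sup>2 * (cmod (c (Suc n) - c n))\<^sup>2 + 2 * K\<^sup>2 * (cmod (c n) / real n)\<^sup>2"
proof -
  have 1: "cmod (m (Suc n) * (c (Suc n) - c n)) \<le> B * cmod (c (Suc n) - c n)"
    unfolding norm_mult by (intro mult_right_mono assms) auto
  have 2: "cmod ((m (Suc n) - m n) * c n) \<le> K * (cmod (c n) / real n)"
  proof (cases "n = 0")
    case True
    then show ?thesis using assms(1) by simp
  next
    case False
    then have "cmod ((m (Suc n) - m n) * c n) \<le> K / real n * cmod (c n)"
      unfolding norm_mult by (intro mult_right_mono assms) auto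
    then show ?thesis by simp
  qed
  have "(cmod (diag_op m c (Suc n) - diag_op m c n))\<^sup>2
      \<le> 2 * (cmod (m (Suc n) * (c (Suc n) - c n)))\<^sup>2 + 2 * (cmod ((m (Suc n) - m n) * c n))\<^sup>2"
    unfolding diag_op_increment by (rule norm_add_squared_le)
  also have "\<dots> \<le> 2 * (B * cmod (c (Suc n) - c n))\<^sup>2 + 2 * (K * (cmod (c n) / real n))\<^sup>2"
    using power_mono [OF 1, of 2] power_mono [OF 2, of 2] by simp
  finally show ?thesis
    by (simp only: power_mult_distrib mult.assoc)
qed

text \<open>The pointwise bound is summed; the constant \<open>4\<close> of Hardy's inequality turns
  \<open>2 * K\<^sup>2\<close> into \<open>8 * K\<^sup>2\<close>.\<close>

lemma diag_op_bounded:
  assumes c: "c \<in> ell2_Delta" and m: "\<And>n. 1 \<le> n \<Longrightarrow> cmod (m n) \<le> B"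
    "\<And>n. 1 \<le> n \<Longrightarrow> cmod (m (Suc n) - m n) \<le> K / real n"
  shows "diag_op m c \<in> ell2_Delta"
    and "increment_energy (diag_op m c) \<le> (2 * B\<^sup>2 + 8 * K\<^sup>2) * increment_energy c"
proof -
  let ?g = "\<lambda>n. 2 * B\<^sup>2 * (cmod (c (Suc n) - c n))\<^sup>2 + 2 * K\<^sup>2 * (cmod (c n) / real n)\<^sup>2"
  note le = diag_op_increment_le [of c m B K, OF ell2_Delta_zeroD [OF c] m]
  have g: "summable ?g"
    by (intro summable_add summable_mult hardy ell2_Delta_summableD c)
  have s: "summable (\<lambda>n. (cmod (diag_op m c (Suc n) - diag_op m c n))\<^sup>2)"
    by (rule summable_comparison_test' [OF g, of 0]) (use le in auto)
  then show "diag_op m c \<in> ell2_Delta"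
    using ell2_Delta_zeroD [OF c] by (simp add: ell2_Delta_def diag_op_def)
  have "increment_energy (diag_op m c) \<le> suminf ?g"
    unfolding increment_energy_def using le s g by (rule suminf_le)
  also have "\<dots> = 2 * B\<^sup>2 * increment_energy c + 2 * K\<^sup>2 * (\<Sum>n. (cmod (c n) / real n)\<^sup>2)"
    unfolding increment_energy_def
    by (subst suminf_add [symmetric])
      (auto intro!: summable_mult suminf_mult [symmetric] hardy ell2_Delta_summableD c simp: suminf_mult hardy ell2_Delta_summableD c)
  also have "\<dots> \<le> 2 * B\<^sup>2 * increment_energy c + 2 * K\<^sup>2 * (4 * increment_energy c)"
    using hardy(2) [OF c] by (intro add_left_mono mult_left_mono) auto
  finally show "increment_energy (diag_op m c) \<le> (2 * B\<^sup>2 + 8 * K\<^sup>2) * increment_energy c"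
    by (simp add: algebra_simps)
qed

text \<open>Dominated convergence for series (Tannery's theorem): each increment tends to
  \<open>0\<close>, and the uniform \<open>B\<close> and \<open>K\<close> supply a summable majorant
  independent of \<open>x\<close>.\<close>

lemma diag_op_tendsto_zero:
  assumes c: "c \<in> ell2_Delta"
    and B: "\<forall>\<^sub>F x in F. \<forall>n\<ge>1. cmod (m x n) \<le> B"
    and K: "\<forall>\<^sub>F x in F. \<forall>n\<ge>1. cmod (m x (Suc n) - m x n) \<le> K / real n"
    and lim: "\<And>n. 1 \<le> n \<Longrightarrow> ((\<lambda>x. m x n) \<longlongrightarrow> 0) F"
  shows "((\<lambda>x. increment_energy (diag_op (m x) c)) \<longlongrightarrow> 0) F"
proof (cases "F = bot")
  case False
  have coord: "((\<lambda>x. diag_op (m x) c n) \<longlongrightarrow> 0) F" for n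
  proof (cases "n = 0")
    case True
    then show ?thesis
      using ell2_Delta_zeroD [OF c] by (simp add: diag_op_def)
  next
    case False
    then show ?thesis
      using tendsto_mult_left_zero [OF lim [of n]] by (simp add: diag_op_def)
  qed
  have "((\<lambda>x. (cmod (diag_op (m x) c (Suc n) - diag_op (m x) c n))\<^sup>2) \<longlongrightarrow> (cmod (0 - 0))\<^sup>2) F" for n
    by (intro tendsto_intros coord)
  then have lim0: "((\<lambda>x. (cmod (diag_op (m x) c (Suc n) - diag_op (m x) c n))\<^sup>2) \<longlongrightarrow> 0) F" for n
    by simp
  let ?g = "\<lambda>n. 2 * B\<^sup>2 * (cmod (c (Suc n) - c n))\<^sup>2 + 2 * K\<^sup>2 * (cmod (c n) / real n)\<^sup>2"
  have "\<forall>\<^sub>F x in F. \<forall>n. (cmod (diag_op (m x) c (Suc n) - diag_op (m x) c n))\<^sup>2 \<le> ?g n"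
    using B K
    by eventually_elim (use diag_op_increment_le ell2_Delta_zeroD [OF c] in blast)
  \<comment> \<open>Tannery's theorem asks for the bound eventually in a product filter; since it
    holds for all \<open>n\<close> at once, it lifts from \<open>F\<close>.\<close>
  then have "\<forall>\<^sub>F (n :: nat, x) in at_top \<times>\<^sub>F F.
      \<forall>n. (cmod (diag_op (m x) c (Suc n) - diag_op (m x) c n))\<^sup>2 \<le> ?g n"
    by (subst eventually_prod2) simp_all
  then have "\<forall>\<^sub>F (n, x) in at_top \<times>\<^sub>F F.
      norm ((cmod (diag_op (m x) c (Suc n) - diag_op (m x) c n))\<^sup>2) \<le> ?g n"
    by (rule eventually_mono) auto
  moreover have "summable ?g"
    by (intro summable_add summable_mult hardy ell2_Delta_summableD c)
  ultimately have "((\<lambda>x. \<Sum>n. (cmod (diag_op (m x) c (Suc n) - diag_op (m x) c n))\<^sup>2) \<longlongrightarrow> (\<Sum>n. 0)) F"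
    by (rule tannerys_theorem [OF lim0 _ _ False, THEN conjunct2, THEN conjunct2])
  then show ?thesis
    by (simp add: increment_energy_def)
qed simp

subsection \<open>Riesz bases and the norm of \<open>H\<^sub>1\<close>\<close>

lemma cinner_add_right: "cinner x (y + z) = cinner x y + cinner x z" for x :: "'a::complex_hilbert"
  using cinner_commute [of x "y + z"] cinner_commute [of x y] cinner_commute [of x z]
  by (simp add: cinner_add_left)

lemma cinner_scaleC_right: "cinner x (a *\<^sub>C y) = cnj a * cinner x y" for x :: "'a::complex_hilbert"
  using cinner_commute [of x "a *\<^sub>C y"] cinner_commute [of x y]
  by (simp add: cinner_scaleC_left)

lemma cinner_zero_left: "cinner 0 y = 0" for y :: "'a::complex_hilbert"
  using cinner_add_left [of 0 0 y] by simp

lemma cinner_sum_left: "cinner (sum f A) y = (\<Sum>x\<in>A. cinner (f x) y)" for y :: "'a::complex_hilbert"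
  by (induction A rule: infinite_finite_induct) (simp_all add: cinner_zero_left cinner_add_left)

lemma norm_scaleC: "norm (a *\<^sub>C x) = cmod a * norm x" for x :: "'a::complex_hilbert"
proof -
  have "complex_of_real ((norm (a *\<^sub>C x))\<^sup>2) = (a * cnj a) * complex_of_real ((norm x)\<^sup>2)"
    unfolding cinner_self [symmetric] by (simp add: cinner_scaleC_left cinner_scaleC_right)
  also have "\<dots> = complex_of_real ((cmod a * norm x)\<^sup>2)"
    by (simp add: complex_norm_square [symmetric] power_mult_distrib)
  finally have "(norm (a *\<^sub>C x))\<^sup>2 = (cmod a * norm x)\<^sup>2"
    by (simp only: of_real_eq_iff)
  then show ?thesis
    by simp
qed

text \<open>Boundedness over the reals allows a complex scalar to be pulled out of an infinite
  sum.\<close>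

lemma bounded_linear_scaleC: "bounded_linear (scaleC a :: 'a::complex_hilbert \<Rightarrow> 'a)"
proof (rule bounded_linear_intro)
  show "a *\<^sub>C (r *\<^sub>R x) = r *\<^sub>R (a *\<^sub>C x)" for r and x :: 'a
    by (simp add: scaleC_of_real [symmetric] scaleC_scaleC mult.commute)
  show "norm (a *\<^sub>C x) \<le> norm x * cmod a" for x :: 'a
    by (simp add: norm_scaleC)
qed (rule scaleC_add_right)

lemma norm_add_orthogonal:
  fixes x y :: "'a::complex_hilbert"
  assumes "cinner x y = 0"
  shows "(norm (x + y))\<^sup>2 = (norm x)\<^sup>2 + (norm y)\<^sup>2"
proof -
  have "cinner y x = 0"
    using assms cinner_commute [of y x] by simp
  then have "complex_of_real ((norm (x + y))\<^sup>2) = complex_of_real ((norm x)\<^sup>2 + (norm y)\<^sup>2)"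
    using assms unfolding of_real_add cinner_self [symmetric]
    by (simp add: cinner_add_left cinner_add_right)
  then show ?thesis
    by (simp only: of_real_eq_iff)
qed

lemma norm_orthonormal_sum:
  fixes g :: "'i \<Rightarrow> 'a::complex_hilbert"
  assumes "\<And>m n. cinner (g m) (g n) = (if m = n then 1 else 0)" and "finite A"
  shows "(norm (\<Sum>n\<in>A. a n *\<^sub>C g n))\<^sup>2 = (\<Sum>n\<in>A. (cmod (a n))\<^sup>2)"
  using \<open>finite A\<close>
proof (induction A)
  case (insert i A)
  have "complex_of_real ((norm (g i))\<^sup>2) = complex_of_real 1"
    using assms(1) [of i i] by (simp add: cinner_self)
  then have "norm (g i) = 1"
    unfolding of_real_eq_iff using power2_eq_imp_eq [of "norm (g i)" 1] by simp
  moreover have "cinner (\<Sum>n\<in>A. a n *\<^sub>C g n) (a i *\<^sub>C g i) = 0"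
    unfolding cinner_sum_left using insert.hyps
    by (intro sum.neutral) (auto simp: cinner_scaleC_left cinner_scaleC_right assms(1))
  ultimately show ?case
    using insert norm_add_orthogonal [of "\<Sum>n\<in>A. a n *\<^sub>C g n" "a i *\<^sub>C g i"]
    by (simp add: norm_scaleC add.commute)
qed simp

text \<open>Pythagoras on finite blocks reduces the Cauchy criterion to that for the squared
  coefficients; Parseval's identity follows by continuity of the norm.\<close>

lemma orthonormal_series:
  fixes g :: "nat \<Rightarrow> 'a::complex_hilbert"
  assumes g: "\<And>m n. cinner (g m) (g n) = (if m = n then 1 else 0)"
    and a: "summable (\<lambda>n. (cmod (a n))\<^sup>2)"
  shows "summable (\<lambda>n. a n *\<^sub>C g n)"
    and "norm (\<Sum>n. a n *\<^sub>C g n) = sqrt (\<Sum>n. (cmod (a n))\<^sup>2)"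
proof -
  show s: "summable (\<lambda>n. a n *\<^sub>C g n)"
    unfolding summable_Cauchy
  proof (intro allI impI)
    fix \<epsilon> :: real
    assume "0 < \<epsilon>"
    then have "0 < \<epsilon>\<^sup>2"
      by simp
    then obtain N where N: "\<And>m n. N \<le> m \<Longrightarrow> norm (\<Sum>k=m..<n. (cmod (a k))\<^sup>2) < \<epsilon>\<^sup>2"
      using a unfolding summable_Cauchy by blast
    have "norm (\<Sum>k=m..<n. a k *\<^sub>C g k) < \<epsilon>" if "N \<le> m" for m n
    proof (rule power_less_imp_less_base)
      show "(norm (\<Sum>k=m..<n. a k *\<^sub>C g k))\<^sup>2 < \<epsilon>\<^sup>2"
        using N [OF that, of n] norm_orthonormal_sum [OF g, of "{m..<n}" a] by simp
    qed (use \<open>0 < \<epsilon>\<close> in simp)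
    then show "\<exists>N. \<forall>m\<ge>N. \<forall>n. norm (\<Sum>k=m..<n. a k *\<^sub>C g k) < \<epsilon>"
      by blast
  qed
  have "(\<lambda>N. (norm (\<Sum>n<N. a n *\<^sub>C g n))\<^sup>2) \<longlonglongrightarrow> (norm (\<Sum>n. a n *\<^sub>C g n))\<^sup>2"
    by (intro tendsto_intros summable_LIMSEQ s)
  moreover have "(\<lambda>N. (norm (\<Sum>n<N. a n *\<^sub>C g n))\<^sup>2) \<longlonglongrightarrow> (\<Sum>n. (cmod (a n))\<^sup>2)"
    using summable_LIMSEQ [OF a] by (simp add: norm_orthonormal_sum [OF g])
  ultimately have "(norm (\<Sum>n. a n *\<^sub>C g n))\<^sup>2 = (\<Sum>n. (cmod (a n))\<^sup>2)"
    by (rule LIMSEQ_unique)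
  then show "norm (\<Sum>n. a n *\<^sub>C g n) = sqrt (\<Sum>n. (cmod (a n))\<^sup>2)"
    by (intro real_sqrt_unique [symmetric]) simp_all
qed

section \<open>From a Riesz basis to two-sided norm bounds\<close>

lemma bounded_clinear_scaleC: "bounded_clinear S \<Longrightarrow> S (a *\<^sub>C x) = a *\<^sub>C S x"
  by (simp add: bounded_clinear_def Vector_Spaces.linear_iff)

lemma bounded_clinear_imp_bounded_linear:
  assumes "bounded_clinear S"
  shows "bounded_linear S"
proof -
  obtain K where "\<And>x. norm (S x) \<le> K * norm x"
    using assms unfolding bounded_clinear_def by blast
  moreover have "S (x + y) = S x + S y" for x y
    using assms by (simp add: bounded_clinear_def Vector_Spaces.linear_iff)
  moreover have "S (r *\<^sub>R x) = r *\<^sub>R S x" for r x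
    using bounded_clinear_scaleC [OF assms] by (simp add: scaleC_of_real [symmetric])
  ultimately show ?thesis
    by (intro bounded_linear_intro [where K = K]) (simp_all add: mult.commute)
qed

text \<open>\<open>A\<close> bounds the map from square summable coefficients to vectors,
  \<open>B\<close> its inverse on the range. The shift to \<open>e (Suc n)\<close> makes the
  coefficients the increments, beginning with \<open>c 1 - c 0\<close>.\<close>

locale riesz_sequence =
  fixes e :: "nat \<Rightarrow> 'h::complex_hilbert" and A B :: real
  assumes A_pos: "0 < A" and B_pos: "0 < B"
    and summable_series: "summable (\<lambda>n. (cmod (a n))\<^sup>2) \<Longrightarrow> summable (\<lambda>n. a n *\<^sub>C e (Suc n))"
    and norm_series_le: "summable (\<lambda>n. (cmod (a n))\<^sup>2) \<Longrightarrow>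
      norm (\<Sum>n. a n *\<^sub>C e (Suc n)) \<le> A * sqrt (\<Sum>n. (cmod (a n))\<^sup>2)"
    and series_norm_ge: "summable (\<lambda>n. (cmod (a n))\<^sup>2) \<Longrightarrow>
      sqrt (\<Sum>n. (cmod (a n))\<^sup>2) \<le> B * norm (\<Sum>n. a n *\<^sub>C e (Suc n))"

text \<open>Since \<open>e n = S (f n)\<close>, Parseval's identity for \<open>f\<close> is carried
  through \<open>S\<close> and back through its inverse \<open>R\<close>; \<open>A\<close> and
  \<open>B\<close> are bounds for \<open>S\<close> and \<open>R\<close>.\<close>

lemma riesz_basis_imp_riesz_sequence:
  assumes "riesz_basis {1..} e"
  obtains A B where "riesz_sequence e A B"
proof -
  obtain f S R where f: "orthonormal_basis {1..} f" and S: "bounded_clinear S" and R: "bounded_clinear R"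
    and RS: "R \<circ> S = id" and e: "\<And>n. n \<in> {1..} \<Longrightarrow> e n = S (f n)"
    using assms unfolding riesz_basis_def by blast
  note S' = bounded_clinear_imp_bounded_linear [OF S]
  note R' = bounded_clinear_imp_bounded_linear [OF R]
  obtain A where A: "0 < A" "\<And>x. norm (S x) \<le> norm x * A"
    using bounded_linear.pos_bounded [OF S'] by blast
  obtain B where B: "0 < B" "\<And>x. norm (R x) \<le> norm x * B"
    using bounded_linear.pos_bounded [OF R'] by blast
  define g where "g n = f (Suc n)" for n
  have g: "cinner (g m) (g n) = (if m = n then 1 else 0)" for m n
    using f by (simp add: orthonormal_basis_def g_def)
  have eS: "a n *\<^sub>C e (Suc n) = S (a n *\<^sub>C g n)" for a n
    by (simp add: e g_def bounded_clinear_scaleC [OF S])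
  have sums: "(\<lambda>n. a n *\<^sub>C e (Suc n)) sums S (\<Sum>n. a n *\<^sub>C g n)"
    if "summable (\<lambda>n. (cmod (a n))\<^sup>2)" for a
    unfolding eS by (intro bounded_linear.sums [OF S'] summable_sums orthonormal_series g that)
  show thesis
  proof
    show "riesz_sequence e A B"
    proof
      fix a :: "nat \<Rightarrow> complex"
      assume a: "summable (\<lambda>n. (cmod (a n))\<^sup>2)"
      show "summable (\<lambda>n. a n *\<^sub>C e (Suc n))"
        using sums [OF a] by (rule sums_summable)
      show "norm (\<Sum>n. a n *\<^sub>C e (Suc n)) \<le> A * sqrt (\<Sum>n. (cmod (a n))\<^sup>2)"
        using A(2) [of "\<Sum>n. a n *\<^sub>C g n"]
        by (simp add: sums_unique [OF sums [OF a], symmetric] orthonormal_series(2) [OF g a] mult.commute)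
      have "sqrt (\<Sum>n. (cmod (a n))\<^sup>2) = norm (R (S (\<Sum>n. a n *\<^sub>C g n)))"
        using RS by (simp add: orthonormal_series(2) [OF g a] fun_eq_iff)
      also have "\<dots> \<le> B * norm (\<Sum>n. a n *\<^sub>C e (Suc n))"
        using B(2) by (simp add: sums_unique [OF sums [OF a], symmetric] mult.commute)
      finally show "sqrt (\<Sum>n. (cmod (a n))\<^sup>2) \<le> B * norm (\<Sum>n. a n *\<^sub>C e (Suc n))" .
    qed (use A B in auto)
  qed
qed

section \<open>The Banach space structure of H_1\<close>

interpretation seq: vector_space seq_scale
  by unfold_locales (simp_all add: seq_scale_def fun_eq_iff algebra_simps)

lemma subspace_ell2_Delta: "seq.subspace ell2_Delta"
proof (rule seq.subspaceI)
  show "0 \<in> ell2_Delta"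
    by (simp add: ell2_Delta_def)
next
  fix c d
  assume c: "c \<in> ell2_Delta" and d: "d \<in> ell2_Delta"
  have "summable (\<lambda>n. 2 * (cmod (c (Suc n) - c n))\<^sup>2 + 2 * (cmod (d (Suc n) - d n))\<^sup>2)"
    by (intro summable_add summable_mult ell2_Delta_summableD c d)
  then have "summable (\<lambda>n. (cmod ((c + d) (Suc n) - (c + d) n))\<^sup>2)"
  proof (rule summable_comparison_test' [where N = 0])
    show "norm ((cmod ((c + d) (Suc n) - (c + d) n))\<^sup>2)
        \<le> 2 * (cmod (c (Suc n) - c n))\<^sup>2 + 2 * (cmod (d (Suc n) - d n))\<^sup>2" for n
      using norm_add_squared_le [of "c (Suc n) - c n" "d (Suc n) - d n"] by (simp add: algebra_simps)
  qed
  then show "c + d \<in> ell2_Delta"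
    using c d by (simp add: ell2_Delta_def)
next
  fix a c
  assume c: "c \<in> ell2_Delta"
  have "summable (\<lambda>n. (cmod a)\<^sup>2 * (cmod (c (Suc n) - c n))\<^sup>2)"
    by (intro summable_mult ell2_Delta_summableD c)
  then show "seq_scale a c \<in> ell2_Delta"
    using c by (simp add: ell2_Delta_def seq_scale_def norm_mult power_mult_distrib flip: right_diff_distrib)
qed

context riesz_sequence
begin

lemma H1_norm_le_energy: "c \<in> ell2_Delta \<Longrightarrow> H1_norm e c \<le> A * sqrt (increment_energy c)"
  unfolding H1_norm_def increment_energy_def by (intro norm_series_le ell2_Delta_summableD)

lemma energy_le_H1_norm: "c \<in> ell2_Delta \<Longrightarrow> sqrt (increment_energy c) \<le> B * H1_norm e c"
  unfolding H1_norm_def increment_energy_def by (intro series_norm_ge ell2_Delta_summableD)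

text \<open>Continuity of the coordinates identifies limits, both in the completeness proof and for
  the generator.\<close>

lemma coordinate_le_H1_norm:
  assumes "c \<in> ell2_Delta"
  shows "cmod (c n) \<le> real n * (B * H1_norm e c)"
  by (rule order_trans [OF coordinate_le_energy [OF assms]])
    (intro mult_left_mono energy_le_H1_norm assms of_nat_0_le_iff)

lemma H1_norm_tendsto_zero:
  assumes "((\<lambda>x. increment_energy (c x)) \<longlongrightarrow> 0) F" and "\<forall>\<^sub>F x in F. c x \<in> ell2_Delta"
  shows "((\<lambda>x. H1_norm e (c x)) \<longlongrightarrow> 0) F"
proof (rule tendsto_sandwich)
  show "\<forall>\<^sub>F x in F. 0 \<le> H1_norm e (c x)"
    by (simp add: H1_norm_def)
  show "\<forall>\<^sub>F x in F. H1_norm e (c x) \<le> A * sqrt (increment_energy (c x))"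
    using assms(2) by eventually_elim (rule H1_norm_le_energy)
  show "((\<lambda>x. A * sqrt (increment_energy (c x))) \<longlongrightarrow> 0) F"
    using tendsto_mult_right_zero [OF tendsto_real_sqrt [OF assms(1), simplified]] .
qed simp

lemma H1_norm_diag_op_tendsto_zero:
  assumes c: "c \<in> ell2_Delta"
    and B: "\<forall>\<^sub>F x in F. \<forall>n\<ge>1. cmod (m x n) \<le> b"
    and K: "\<forall>\<^sub>F x in F. \<forall>n\<ge>1. cmod (m x (Suc n) - m x n) \<le> K / real n"
    and lim: "\<And>n. 1 \<le> n \<Longrightarrow> ((\<lambda>x. m x n) \<longlongrightarrow> 0) F"
  shows "((\<lambda>x. H1_norm e (diag_op (m x) c)) \<longlongrightarrow> 0) F"
proof (rule H1_norm_tendsto_zero)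
  show "\<forall>\<^sub>F x in F. diag_op (m x) c \<in> ell2_Delta"
    using B K by eventually_elim (rule diag_op_bounded [OF c]; blast)
qed (rule diag_op_tendsto_zero [OF assms])

text \<open>The limit is found coordinatewise. As in Fatou's lemma, bounds on finite partial sums of
  the energy survive the pointwise limit and hence hold for the whole energy.\<close>

lemma H1_complete:
  fixes s :: "nat \<Rightarrow> nat \<Rightarrow> complex"
  assumes s: "\<And>n. s n \<in> ell2_Delta"
    and cauchy: "\<And>\<epsilon>. 0 < \<epsilon> \<Longrightarrow> \<exists>M. \<forall>m\<ge>M. \<forall>n\<ge>M. H1_norm e (s m - s n) < \<epsilon>"
  shows "\<exists>c\<in>ell2_Delta. (\<lambda>n. H1_norm e (s n - c)) \<longlonglongrightarrow> 0"
proof -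
  have diff: "s m - s n \<in> ell2_Delta" for m n
    by (intro seq.subspace_diff subspace_ell2_Delta s)
  have "convergent (\<lambda>k. s k j)" for j
  proof (rule Cauchy_convergent, rule CauchyI)
    fix \<epsilon> :: real
    assume "0 < \<epsilon>"
    \<comment> \<open>\<open>Suc j\<close> instead of \<open>j\<close> keeps the divisor positive at
      \<open>j = 0\<close>.\<close>
    then have "0 < \<epsilon> / (real (Suc j) * B)"
      using B_pos by simp
    then obtain M where M: "\<And>m n. M \<le> m \<Longrightarrow> M \<le> n \<Longrightarrow> H1_norm e (s m - s n) < \<epsilon> / (real (Suc j) * B)"
      using cauchy by blast
    have "norm (s m j - s n j) < \<epsilon>" if "M \<le> m" "M \<le> n" for m n
    proof -
      have "norm (s m j - s n j) \<le> real j * (B * H1_norm e (s m - s n))"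
        using coordinate_le_H1_norm [OF diff, of m n j] by simp
      also have "\<dots> \<le> real (Suc j) * (B * H1_norm e (s m - s n))"
        using B_pos by (intro mult_right_mono) (auto simp: H1_norm_def)
      also have "\<dots> < \<epsilon>"
        using M [OF that] B_pos by (simp add: pos_less_divide_eq mult_ac)
      finally show ?thesis .
    qed
    then show "\<exists>M. \<forall>m\<ge>M. \<forall>n\<ge>M. norm (s m j - s n j) < \<epsilon>"
      by blast
  qed
  then obtain c where c: "\<And>j. (\<lambda>k. s k j) \<longlonglongrightarrow> c j"
    unfolding convergent_def by metis
  have c0: "c 0 = 0"
    using LIMSEQ_unique [OF c [of 0], of 0] ell2_Delta_zeroD [OF s] by simp
  \<comment> \<open>It is not yet known that \<open>c\<close> lies in \<open>ell2_Delta\<close>, so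
    membership of the difference is obtained together with its small energy.\<close>
  have ev: "\<exists>M. \<forall>m\<ge>M. s m - c \<in> ell2_Delta \<and> increment_energy (s m - c) \<le> \<epsilon>\<^sup>2" if "0 < \<epsilon>" for \<epsilon>
  proof -
    have "0 < \<epsilon> / B"
      using that B_pos by simp
    then obtain M where M: "\<And>m n. M \<le> m \<Longrightarrow> M \<le> n \<Longrightarrow> H1_norm e (s m - s n) < \<epsilon> / B"
      using cauchy by blast
    have "s m - c \<in> ell2_Delta \<and> increment_energy (s m - c) \<le> \<epsilon>\<^sup>2" if "M \<le> m" for m
    proof -
      have E: "increment_energy (s m - s n) \<le> \<epsilon>\<^sup>2" if "M \<le> n" for n
      proof -
        have "sqrt (increment_energy (s m - s n)) \<le> B * H1_norm e (s m - s n)"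
          by (rule energy_le_H1_norm [OF diff])
        also have "\<dots> \<le> \<epsilon>"
          using M [OF \<open>M \<le> m\<close> that] B_pos by (simp add: pos_less_divide_eq mult_ac)
        finally show ?thesis
          by (rule sqrt_le_D)
      qed
      \<comment> \<open>With \<open>m\<close> and \<open>J\<close> fixed, \<open>n\<close> tends to
        infinity inside a finite sum.\<close>
      have le: "(\<Sum>j<J. (cmod ((s m - c) (Suc j) - (s m - c) j))\<^sup>2) \<le> \<epsilon>\<^sup>2" for J
      proof (rule LIMSEQ_le_const2)
        show "(\<lambda>n. \<Sum>j<J. (cmod ((s m - s n) (Suc j) - (s m - s n) j))\<^sup>2)
            \<longlonglongrightarrow> (\<Sum>j<J. (cmod ((s m - c) (Suc j) - (s m - c) j))\<^sup>2)"
          by (simp only: minus_apply) (intro tendsto_intros c)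
        show "\<exists>N. \<forall>n\<ge>N. (\<Sum>j<J. (cmod ((s m - s n) (Suc j) - (s m - s n) j))\<^sup>2) \<le> \<epsilon>\<^sup>2"
          by (intro exI [of _ M] allI impI order_trans [OF sum_increments_le_energy [OF diff]] E)
      qed
      then have "summable (\<lambda>j. (cmod ((s m - c) (Suc j) - (s m - c) j))\<^sup>2)"
        by (intro summableI_nonneg_bounded) simp_all
      with le show ?thesis
        using ell2_Delta_zeroD [OF s, of m] c0
        by (simp add: ell2_Delta_def increment_energy_def suminf_le_const)
    qed
    then show ?thesis by blast
  qed
  obtain M where "s M - c \<in> ell2_Delta"
    using ev [of 1] by auto
  \<comment> \<open>\<open>c\<close> is recovered as a difference of two members of the
    subspace.\<close>
  from seq.subspace_diff [OF subspace_ell2_Delta s [of M] this] have "s M - (s M - c) \<in> ell2_Delta" .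
  moreover have "s M - (s M - c) = c"
    by (rule ext) simp
  ultimately have cX: "c \<in> ell2_Delta"
    by (simp only:)
  have "(\<lambda>n. H1_norm e (s n - c)) \<longlonglongrightarrow> 0"
  proof (rule H1_norm_tendsto_zero)
    show "\<forall>\<^sub>F n in sequentially. s n - c \<in> ell2_Delta"
      by (intro always_eventually allI seq.subspace_diff subspace_ell2_Delta s cX)
    show "(\<lambda>n. increment_energy (s n - c)) \<longlonglongrightarrow> 0"
    proof (rule LIMSEQ_I)
      fix r :: real
      assume "0 < r"
      \<comment> \<open>Energy at most \<open>r / 2\<close> yields the strict inequality with
        \<open>r\<close>.\<close>
      then obtain M where "\<forall>m\<ge>M. s m - c \<in> ell2_Delta \<and> increment_energy (s m - c) \<le> (sqrt (r / 2))\<^sup>2"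
        using ev [of "sqrt (r / 2)"] by auto
      then have "norm (increment_energy (s m - c) - 0) < r" if "M \<le> m" for m
        using that \<open>0 < r\<close> increment_energy_nonneg [of "s m - c"] by force
      then show "\<exists>M. \<forall>m\<ge>M. norm (increment_energy (s m - c) - 0) < r"
        by blast
    qed
  qed
  with cX show ?thesis by blast
qed

lemma H1_series_add:
  assumes "c \<in> ell2_Delta" "d \<in> ell2_Delta"
  shows "(\<Sum>n. ((c + d) (Suc n) - (c + d) n) *\<^sub>C e (Suc n)) =
    (\<Sum>n. (c (Suc n) - c n) *\<^sub>C e (Suc n)) + (\<Sum>n. (d (Suc n) - d n) *\<^sub>C e (Suc n))"
proof -
  have "((c + d) (Suc n) - (c + d) n) *\<^sub>C e (Suc n) =
      (c (Suc n) - c n) *\<^sub>C e (Suc n) + (d (Suc n) - d n) *\<^sub>C e (Suc n)" for n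
    by (simp only: plus_fun_apply add_diff_add scaleC_add_left)
  then show ?thesis
    using assms by (simp only: suminf_add summable_series ell2_Delta_summableD)
qed

lemma H1_complex_banach_on: "complex_banach_on seq_scale ell2_Delta (H1_norm e)"
proof
  show "seq.subspace ell2_Delta"
    by (rule subspace_ell2_Delta)
next
  fix c
  assume c: "c \<in> ell2_Delta"
  show "0 \<le> H1_norm e c"
    by (simp add: H1_norm_def)
  show "H1_norm e c = 0 \<longleftrightarrow> c = 0"
  proof
    assume "H1_norm e c = 0"
    then show "c = 0"
      using coordinate_le_H1_norm [OF c] by (simp add: fun_eq_iff)
  next
    assume "c = 0"
    then show "H1_norm e c = 0"
      by (simp add: H1_norm_def)
  qed
  show "H1_norm e (seq_scale a c) = cmod a * H1_norm e c" for a
  proof -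
    have "(\<Sum>n. (seq_scale a c (Suc n) - seq_scale a c n) *\<^sub>C e (Suc n)) =
        (\<Sum>n. a *\<^sub>C ((c (Suc n) - c n) *\<^sub>C e (Suc n)))"
      by (simp only: seq_scale_def scaleC_scaleC right_diff_distrib)
    also have "\<dots> = a *\<^sub>C (\<Sum>n. (c (Suc n) - c n) *\<^sub>C e (Suc n))"
      by (intro bounded_linear.suminf [OF bounded_linear_scaleC, symmetric]
          summable_series ell2_Delta_summableD c)
    finally show ?thesis
      by (simp add: H1_norm_def norm_scaleC)
  qed
next
  fix c d
  assume "c \<in> ell2_Delta" "d \<in> ell2_Delta"
  then show "H1_norm e (c + d) \<le> H1_norm e c + H1_norm e d"
    unfolding H1_norm_def by (simp only: H1_series_add norm_triangle_ineq)
next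
  fix s :: "nat \<Rightarrow> nat \<Rightarrow> complex"
  assume "\<And>n. s n \<in> ell2_Delta"
    and "\<And>\<epsilon>. 0 < \<epsilon> \<Longrightarrow> \<exists>M. \<forall>m\<ge>M. \<forall>n\<ge>M. H1_norm e (s m - s n) < \<epsilon>"
  then show "\<exists>c\<in>ell2_Delta. (\<lambda>n. H1_norm e (s n - c)) \<longlonglongrightarrow> 0"
    by (rule H1_complete)
qed

end

subsection \<open>The group and its generator\<close>

definition log_rotation :: "real \<Rightarrow> nat \<Rightarrow> complex" where
  "log_rotation t n = exp (\<i> * complex_of_real (t * ln (real n)))"

lemma cmod_log_rotation: "cmod (log_rotation t n) = 1"
  by (simp add: log_rotation_def)

lemma log_rotation_increment_le:
  assumes "1 \<le> n"
  shows "cmod (log_rotation t (Suc n) - log_rotation t n) \<le> \<bar>t\<bar> / real n"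
proof -
  have "cmod (log_rotation t (Suc n) - log_rotation t n) \<le> \<bar>t * ln (real (Suc n)) - t * ln (real n)\<bar>"
    unfolding log_rotation_def by (rule cmod_exp_imaginary_diff_le)
  also have "\<dots> = \<bar>t\<bar> * \<bar>ln (real (Suc n)) - ln (real n)\<bar>"
    by (simp only: right_diff_distrib [symmetric] abs_mult)
  also have "\<dots> \<le> \<bar>t\<bar> * (1 / real n)"
    using ln_Suc_diff_le [OF assms] by (rule mult_left_mono) simp
  finally show ?thesis by simp
qed

text \<open>Splits the difference quotient of the symbol into a factor bounded uniformly in
  \<open>h\<close> and \<open>n\<close> and the unbounded symbol of the generator.\<close>

lemma log_rotation_diff_quotient:
  "h \<noteq> 0 \<Longrightarrow> (log_rotation h n - 1) / complex_of_real h =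
    exp_quotient (h * ln (real n)) * (\<i> * complex_of_real (ln (real n)))"
  using exp_quotient_mult [of "h * ln (real n)"]
  by (simp add: log_rotation_def field_simps)

lemma exp_quotient_tendsto: "((\<lambda>h. exp_quotient (h * L)) \<longlongrightarrow> 1) (at 0)"
proof (rule LIM_zero_cancel, rule Lim_null_comparison)
  show "\<forall>\<^sub>F h in at 0. cmod (exp_quotient (h * L) - 1) \<le> \<bar>h * L\<bar>"
    using exp_quotient_diff_le [of _ 0] by (simp add: exp_quotient_0)
  show "((\<lambda>h. \<bar>h * L\<bar>) \<longlongrightarrow> 0) (at 0)"
    by (rule tendsto_eq_intros refl | simp)+
qed

context riesz_sequence
begin

lemma log_rotation_C0_group:
  "C0_group seq_scale ell2_Delta (H1_norm e) (\<lambda>t. diag_op (log_rotation t))"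
proof (intro C0_group.intro H1_complex_banach_on C0_group_axioms.intro)
  fix c :: "nat \<Rightarrow> complex" and t
  assume c: "c \<in> ell2_Delta"
  show "diag_op (log_rotation t) c \<in> ell2_Delta"
    by (rule diag_op_bounded [OF c, of _ 1]) (simp add: cmod_log_rotation, rule log_rotation_increment_le)
  show "diag_op (log_rotation 0) c = c"
    by (simp add: diag_op_def log_rotation_def)
  show "diag_op (log_rotation (s + t)) c = diag_op (log_rotation s) (diag_op (log_rotation t) c)" for s
    by (simp add: diag_op_def log_rotation_def fun_eq_iff algebra_simps exp_add)
  show "((\<lambda>s. H1_norm e (diag_op (log_rotation s) c - diag_op (log_rotation t) c)) \<longlongrightarrow> 0) (at t)"
  proof -
    have eq: "diag_op (log_rotation s) c - diag_op (log_rotation t) c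
        = diag_op (\<lambda>n. log_rotation s n - log_rotation t n) c" for s
      by (simp add: diag_op_def fun_eq_iff algebra_simps)
    show ?thesis
      unfolding eq
    proof (rule H1_norm_diag_op_tendsto_zero [OF c])
      have "cmod (log_rotation s n - log_rotation t n) \<le> 2" for s n
        using norm_triangle_ineq4 [of "log_rotation s n" "log_rotation t n"]
        by (simp add: cmod_log_rotation)
      then show "\<forall>\<^sub>F s in at t. \<forall>n\<ge>1. cmod (log_rotation s n - log_rotation t n) \<le> 2"
        by simp
      \<comment> \<open>Keeping \<open>s\<close> near \<open>t\<close> makes the increment bound
        uniform: \<open>\<bar>s\<bar> + \<bar>t\<bar> \<le> 2 * \<bar>t\<bar> + 1\<close>.\<close>
      have "\<forall>\<^sub>F s in at t. \<bar>s\<bar> < \<bar>t\<bar> + 1"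
        by (rule order_tendstoD(2) [where y = "\<bar>t\<bar>"]) (auto intro!: tendsto_intros)
      then show "\<forall>\<^sub>F s in at t. \<forall>n\<ge>1. cmod (log_rotation s (Suc n) - log_rotation t (Suc n)
          - (log_rotation s n - log_rotation t n)) \<le> (2 * \<bar>t\<bar> + 1) / real n"
      proof (rule eventually_mono, intro allI impI)
        fix s and n :: nat
        assume s: "\<bar>s\<bar> < \<bar>t\<bar> + 1" and n: "1 \<le> n"
        have "cmod (log_rotation s (Suc n) - log_rotation t (Suc n) - (log_rotation s n - log_rotation t n))
            = cmod ((log_rotation s (Suc n) - log_rotation s n) - (log_rotation t (Suc n) - log_rotation t n))"
          by (simp add: algebra_simps)
        also have "\<dots> \<le> cmod (log_rotation s (Suc n) - log_rotation s n)
            + cmod (log_rotation t (Suc n) - log_rotation t n)"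
          by (rule norm_triangle_ineq4)
        also have "\<dots> \<le> \<bar>s\<bar> / real n + \<bar>t\<bar> / real n"
          by (intro add_mono log_rotation_increment_le n)
        also have "\<dots> \<le> (2 * \<bar>t\<bar> + 1) / real n"
          unfolding add_divide_distrib [symmetric] using s by (intro divide_right_mono) auto
        finally show "cmod (log_rotation s (Suc n) - log_rotation t (Suc n)
          - (log_rotation s n - log_rotation t n)) \<le> (2 * \<bar>t\<bar> + 1) / real n" .
      qed
      show "((\<lambda>s. log_rotation s n - log_rotation t n) \<longlongrightarrow> 0) (at t)" for n
        unfolding log_rotation_def by (rule LIM_zero) (intro tendsto_intros)
    qed
  qed
next
  fix t
  \<comment> \<open>The square root is the constant of \<open>diag_op_bounded\<close> for modulus
    bound \<open>1\<close> and increment bound \<open>\<bar>t\<bar>\<close>; passing from norm to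
    energy and back costs the factor \<open>A * B\<close>.\<close>
  have "H1_norm e (diag_op (log_rotation t) c) \<le> A * sqrt (2 + 8 * t\<^sup>2) * B * H1_norm e c"
    if c: "c \<in> ell2_Delta" for c
  proof -
    note b = diag_op_bounded [OF c, of "log_rotation t" 1 "\<bar>t\<bar>"]
    have "H1_norm e (diag_op (log_rotation t) c) \<le> A * sqrt (increment_energy (diag_op (log_rotation t) c))"
      by (intro H1_norm_le_energy b) (simp_all only: cmod_log_rotation log_rotation_increment_le order_refl)
    also have "\<dots> \<le> A * sqrt ((2 + 8 * t\<^sup>2) * increment_energy c)"
      using b(2) A_pos
      by (intro mult_left_mono real_sqrt_le_mono) (simp_all add: cmod_log_rotation log_rotation_increment_le)
    also have "\<dots> = A * sqrt (2 + 8 * t\<^sup>2) * sqrt (increment_energy c)"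
      by (simp add: real_sqrt_mult)
    also have "\<dots> \<le> A * sqrt (2 + 8 * t\<^sup>2) * (B * H1_norm e c)"
      using A_pos by (intro mult_left_mono energy_le_H1_norm c) simp
    finally show ?thesis
      by (simp only: mult.assoc)
  qed
  then show "\<exists>K. \<forall>c\<in>ell2_Delta. H1_norm e (diag_op (log_rotation t) c) \<le> K * H1_norm e c"
    by blast
qed (simp_all add: diag_op_def seq_scale_def fun_eq_iff algebra_simps)

lemma log_rotation_generator:
  assumes lam: "\<And>n. n \<ge> 1 \<Longrightarrow> lam n = \<i> * complex_of_real (ln (real n))"
  shows "is_generator seq_scale ell2_Delta (H1_norm e) (\<lambda>t. diag_op (log_rotation t))
    (diag_domain lam) (diag_op lam)"
proof -
  let ?gen = "has_generator_value seq_scale (H1_norm e) (\<lambda>t. diag_op (log_rotation t))"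
  define q where
    "q c h = seq_scale (complex_of_real (1 / h)) (diag_op (log_rotation h) c - c)" for c h
  interpret C0_group seq_scale ell2_Delta "H1_norm e" "\<lambda>t. diag_op (log_rotation t)"
    by (rule log_rotation_C0_group)
  \<comment> \<open>The formula holds for every \<open>c\<close> in \<open>ell2_Delta\<close>,
    inside the domain or not, and so serves both inclusions.\<close>
  have q_eq: "q c h n = exp_quotient (h * ln (real n)) * diag_op lam c n"
    if "c \<in> ell2_Delta" "h \<noteq> 0" for c h n
  proof (cases "n = 0")
    case True
    then show ?thesis
      using ell2_Delta_zeroD [OF that(1)] by (simp add: q_def seq_scale_def diag_op_def)
  next
    case False
    have "q c h n = (log_rotation h n - 1) / complex_of_real h * c n"
      by (simp add: q_def seq_scale_def diag_op_def algebra_simps diff_divide_distrib)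
    also have "\<dots> = exp_quotient (h * ln (real n)) * diag_op lam c n"
      using False lam [of n] by (simp add: log_rotation_diff_quotient [OF that(2)] diag_op_def)
    finally show ?thesis .
  qed
  have gen: "?gen c (diag_op lam c)" if c: "c \<in> diag_domain lam" for c
  proof -
    have cX: "c \<in> ell2_Delta" and a: "diag_op lam c \<in> ell2_Delta"
      using c by (auto simp: diag_domain_def)
    \<comment> \<open>This is the error of the difference quotient. Its symbol tends to
      \<open>0\<close> pointwise, and it acts on \<open>diag_op lam c\<close>, which lies in
      \<open>ell2_Delta\<close> by the choice of \<open>c\<close>.\<close>
    have "((\<lambda>h. H1_norm e (diag_op (\<lambda>n. exp_quotient (h * ln (real n)) - 1) (diag_op lam c))) \<longlongrightarrow> 0) (at 0)"
    proof (rule H1_norm_diag_op_tendsto_zero [OF a])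
      have "cmod (exp_quotient x - 1) \<le> 2" for x
        using norm_triangle_ineq4 [of "exp_quotient x" 1] cmod_exp_quotient_le [of x] by simp
      then show "\<forall>\<^sub>F h in at 0. \<forall>n\<ge>1. cmod (exp_quotient (h * ln (real n)) - 1) \<le> 2"
        by simp
      \<comment> \<open>For these \<open>h\<close> the Lipschitz bound of
        \<open>exp_quotient\<close> gives the uniform increment constant \<open>1\<close>.\<close>
      have "\<forall>\<^sub>F h :: real in at 0. \<bar>h\<bar> < 1"
        by (auto simp: eventually_at dist_real_def intro!: exI [of _ 1])
      then show "\<forall>\<^sub>F h in at 0. \<forall>n\<ge>1. cmod (exp_quotient (h * ln (real (Suc n))) - 1
          - (exp_quotient (h * ln (real n)) - 1)) \<le> 1 / real n"
      proof (rule eventually_mono, intro allI impI)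
        fix h :: real and n :: nat
        assume h: "\<bar>h\<bar> < 1" and n: "1 \<le> n"
        have "cmod (exp_quotient (h * ln (real (Suc n))) - 1 - (exp_quotient (h * ln (real n)) - 1))
            \<le> \<bar>h * ln (real (Suc n)) - h * ln (real n)\<bar>"
          using exp_quotient_diff_le by simp
        also have "\<dots> = \<bar>h\<bar> * \<bar>ln (real (Suc n)) - ln (real n)\<bar>"
          by (simp only: right_diff_distrib [symmetric] abs_mult)
        also have "\<dots> \<le> 1 * (1 / real n)"
          using h by (intro mult_mono ln_Suc_diff_le n) auto
        finally show "cmod (exp_quotient (h * ln (real (Suc n))) - 1
            - (exp_quotient (h * ln (real n)) - 1)) \<le> 1 / real n"
          by simp
      qed
      show "((\<lambda>h. exp_quotient (h * ln (real n)) - 1) \<longlongrightarrow> 0) (at 0)" for n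
        by (intro LIM_zero exp_quotient_tendsto)
    qed
    moreover have "\<forall>\<^sub>F h in at 0. H1_norm e (q c h - diag_op lam c)
        = H1_norm e (diag_op (\<lambda>n. exp_quotient (h * ln (real n)) - 1) (diag_op lam c))"
    proof (rule eventually_mono [OF eventually_neq_at_within])
      fix h :: real
      assume "h \<noteq> 0"
      then have "q c h - diag_op lam c
          = diag_op (\<lambda>n. exp_quotient (h * ln (real n)) - 1) (diag_op lam c)"
        by (simp add: fun_eq_iff q_eq [OF cX]) (simp add: diag_op_def algebra_simps)
      then show "H1_norm e (q c h - diag_op lam c)
        = H1_norm e (diag_op (\<lambda>n. exp_quotient (h * ln (real n)) - 1) (diag_op lam c))"
        by simp
    qed
    ultimately show ?thesis
      unfolding has_generator_value_def q_def [symmetric] by (simp add: tendsto_cong)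
  qed
  \<comment> \<open>Norm convergence forces convergence of every coordinate, and the limit of the
    \<open>n\<close>-th coordinate is always \<open>lam n * c n\<close>.\<close>
  have unique: "y = diag_op lam c"
    if c: "c \<in> ell2_Delta" and y: "y \<in> ell2_Delta" and "?gen c y" for c y
  proof
    fix n
    have lim: "((\<lambda>h. H1_norm e (q c h - y)) \<longlongrightarrow> 0) (at 0)"
      using \<open>?gen c y\<close> unfolding has_generator_value_def q_def [symmetric] .
    have "q c h - y \<in> ell2_Delta" for h
      unfolding q_def
      by (intro seq.subspace_diff seq.subspace_scale subspace_ell2_Delta maps_to c y)
    then have "cmod (q c h n - y n) \<le> real n * (B * H1_norm e (q c h - y))" for h
      using coordinate_le_H1_norm [of "q c h - y" n] by simp
    moreover have "((\<lambda>h. real n * (B * H1_norm e (q c h - y))) \<longlongrightarrow> 0) (at 0)"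
      by (intro tendsto_mult_right_zero lim)
    ultimately have "((\<lambda>h. q c h n - y n) \<longlongrightarrow> 0) (at 0)"
      by (rule Lim_null_comparison [OF always_eventually [OF allI]])
    then have "((\<lambda>h. q c h n) \<longlongrightarrow> y n) (at 0)"
      by (rule LIM_zero_cancel)
    moreover have "((\<lambda>h. q c h n) \<longlongrightarrow> diag_op lam c n) (at 0)"
    proof (rule Lim_transform_eventually)
      show "((\<lambda>h. exp_quotient (h * ln (real n)) * diag_op lam c n) \<longlongrightarrow> diag_op lam c n) (at 0)"
        using tendsto_mult [OF exp_quotient_tendsto tendsto_const] by (simp only: mult_1_left)
      show "\<forall>\<^sub>F h in at 0. exp_quotient (h * ln (real n)) * diag_op lam c n = q c h n"
        by (rule eventually_mono [OF eventually_neq_at_within [of 0]]) (simp add: q_eq [OF c])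
    qed
    ultimately show "y n = diag_op lam c n"
      by (rule LIM_unique)
  qed
  have "diag_domain lam = {c \<in> ell2_Delta. \<exists>y\<in>ell2_Delta. ?gen c y}"
  proof (intro Set.set_eqI iffI)
    fix c
    assume "c \<in> diag_domain lam"
    with gen [OF this] show "c \<in> {c \<in> ell2_Delta. \<exists>y\<in>ell2_Delta. ?gen c y}"
      unfolding diag_domain_def by blast
  next
    fix c
    assume "c \<in> {c \<in> ell2_Delta. \<exists>y\<in>ell2_Delta. ?gen c y}"
    then obtain y where "c \<in> ell2_Delta" "y \<in> ell2_Delta" "?gen c y"
      by blast
    \<comment> \<open>As \<open>y\<close> equals \<open>diag_op lam c\<close>, its membership in
      \<open>ell2_Delta\<close> is the domain condition.\<close>
    with unique [OF this] show "c \<in> diag_domain lam"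
      by (simp add: diag_domain_def)
  qed
  moreover have "diag_op lam c \<in> ell2_Delta" if "c \<in> diag_domain lam" for c
    using that by (simp add: diag_domain_def)
  ultimately show ?thesis
    unfolding is_generator_def using gen by (intro conjI ballI)
qed

end

theorem theorem6:
  fixes e :: "nat \<Rightarrow> 'h::complex_hilbert" and lam :: "nat \<Rightarrow> complex"
  assumes "separable_space (euclidean :: 'h topology)" and "infinite_dimensional TYPE('h)"
    and "riesz_basis {1..} e"
    and "\<And>n. n \<ge> 1 \<Longrightarrow> lam n = \<i> * complex_of_real (ln (real n))"
  shows "\<exists>T. C0_group seq_scale ell2_Delta (H1_norm e) T \<and>
             is_generator seq_scale ell2_Delta (H1_norm e) T (diag_domain lam) (diag_op lam) \<and>
             (\<forall>t. \<forall>c\<in>ell2_Delta.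
                T t c = (\<lambda>n. exp (\<i> * complex_of_real (t * ln (real n))) * c n))"
proof -
  obtain A B where "riesz_sequence e A B"
    using riesz_basis_imp_riesz_sequence [OF assms(3)] .
  then interpret riesz_sequence e A B .
  show ?thesis
    using log_rotation_C0_group log_rotation_generator [OF assms(4)]
    by (intro exI [of _ "\<lambda>t. diag_op (log_rotation t)"]) (auto simp: diag_op_def log_rotation_def)
qed

end
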